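(* Let $n\geq 2$ be an integer. Then the constrained inequality $C_n$ is independent of the family consisting of the basic quantum inequalities (strong subadditivity and weak monotonicity) together with $\{C_p\}_{p\geq 1,\,p\neq n}$. Likewise (classical case), $C_n$ is independent of the family consisting of the basic classical inequalities (strong subadditivity and monotonicity) together with $\{C_p\}_{p\geq 1,\,p\neq n}$.
   Context: Let $N$ be a finite set (the ground set of parties). Consider real-linear forms in the values $h(M)$, $M\subseteq N$, of functions $h$ from the power set $\mathbb{P}(N)$ to $\mathbb{R}$ with $h(\emptyset)=0$; two such linear forms are identified if they agree on all such $h$. For disjoint subsets $\alpha,\beta,\gamma\subseteq N$ (possibly empty) write $h(\alpha:\beta|\gamma)=-h(\gamma)+h(\alpha\cup\gamma)+h(\beta\cup\gamma)-h(\alpha\cup\beta\cup\gamma)$. Instances of inequalities on $N$ (each is a linear form required to be $\geq 0$), where all sets are pairwise disjoint subsets of $N$, possibly empty: - Strong subadditivity: $h(\alpha:\beta|\gamma)\geq 0$. - Weak monotonicity: $h(\alpha\cup\beta)+h(\alpha\cup\gamma)-h(\beta)-h(\gamma)\geq 0$. - Monotonicity: $h(\alpha\cup\beta)-h(\alpha)\geq 0$. - For an integer $p\ge 1$, the constrained inequality $C_p$, for disjoint subsets $A,B,C,X_1,\ldots,X_p$ of $N$: $$\sum_{i=1}^p h(A:B|X_i)+\sum_{i=1}^p h(X_i)-h(X_1\cup\cdots\cup X_p)-(p-1)\,h(A\cup B:C|\emptyset)\;\geq\;0,$$ with the two constraints $h(A:C|B)=0$ and $h(B:C|A)=0$ (i.e.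 the inequality is only required to hold for those $h$ which satisfy these constraints). Independence: $C_n$ is independent of a family of inequalities (consisting of some unconstrained inequalities and some of the $C_p$) if there is a ground set $N$ and an instance of $C_n$ on $N$, with constrained parties $A,B,C$, whose left-hand linear form cannot be written as a finite linear combination with non-negative coefficients of (the left-hand linear forms of) instances on $N$ of the inequalities in the family, plus an arbitrary real linear combination of the constraint forms $h(A:C|B)$ and $h(B:C|A)$. Here the only instances of the inequalities $C_p$ that are allowed are those with the same constrained parties $A,B,C$ (the sets $X_1,\ldots,X_p$ being arbitrary), while all instances on $N$ of the unconstrained inequalities are allowed. *)

theory Defs
  imports Complex_Main "HOL-Library.Disjoint_Sets"
begin

(* Linear forms in the values h(M) are represented as the functionals they induce.
   A function h on the power set of N is represented by a total function; every form below
   reads h only at subsets of N. *)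
type_synonym 'a form = "('a set \<Rightarrow> real) \<Rightarrow> real"

(* Forms are identified when they agree on all h with h {} = 0, so all
   identities between forms are stated through this relation. *)
definition same_form :: "'a form \<Rightarrow> 'a form \<Rightarrow> bool" where
  "same_form F G \<longleftrightarrow> (\<forall>h. h {} = 0 \<longrightarrow> F h = G h)"

definition cond_mi :: "'a set \<Rightarrow> 'a set \<Rightarrow> 'a set \<Rightarrow> 'a form" where
  "cond_mi \<alpha> \<beta> \<gamma> h = - h \<gamma> + h (\<alpha> \<union> \<gamma>) + h (\<beta> \<union> \<gamma>) - h (\<alpha> \<union> \<beta> \<union> \<gamma>)"

definition strong_subadditivity :: "'a set \<Rightarrow> 'a form set" where
  "strong_subadditivity N = {cond_mi \<alpha> \<beta> \<gamma> | \<alpha> \<beta> \<gamma>.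
     \<alpha> \<subseteq> N \<and> \<beta> \<subseteq> N \<and> \<gamma> \<subseteq> N \<and> disjnt \<alpha> \<beta> \<and> disjnt \<alpha> \<gamma> \<and> disjnt \<beta> \<gamma>}"

definition weak_monotonicity :: "'a set \<Rightarrow> 'a form set" where
  "weak_monotonicity N = {\<lambda>h. h (\<alpha> \<union> \<beta>) + h (\<alpha> \<union> \<gamma>) - h \<beta> - h \<gamma> | \<alpha> \<beta> \<gamma>.
     \<alpha> \<subseteq> N \<and> \<beta> \<subseteq> N \<and> \<gamma> \<subseteq> N \<and> disjnt \<alpha> \<beta> \<and> disjnt \<alpha> \<gamma> \<and> disjnt \<beta> \<gamma>}"

definition monotonicity :: "'a set \<Rightarrow> 'a form set" where
  "monotonicity N = {\<lambda>h. h (\<alpha> \<union> \<beta>) - h \<alpha> | \<alpha> \<beta>. \<alpha> \<subseteq> N \<and> \<beta> \<subseteq> N \<and> disjnt \<alpha> \<beta>}"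

definition basic_quantum :: "'a set \<Rightarrow> 'a form set" where
  "basic_quantum N = strong_subadditivity N \<union> weak_monotonicity N"

definition basic_classical :: "'a set \<Rightarrow> 'a form set" where
  "basic_classical N = strong_subadditivity N \<union> monotonicity N"

definition C_form :: "nat \<Rightarrow> 'a set \<Rightarrow> 'a set \<Rightarrow> 'a set \<Rightarrow> (nat \<Rightarrow> 'a set) \<Rightarrow> 'a form" where
  "C_form p A B C X h =
     (\<Sum>i=1..p. cond_mi A B (X i) h) + (\<Sum>i=1..p. h (X i)) - h (\<Union>i\<in>{1..p}. X i)
     - (real p - 1) * cond_mi (A \<union> B) C {} h"

(* Sets may be empty, so several of the X i may coincide with the empty set;
   disjoint_family_on allows this, unlike disjointness of the set of all X i. *)
definition C_parties ::
    "'a set \<Rightarrow> nat \<Rightarrow> 'a set \<Rightarrow> 'a set \<Rightarrow> 'a set \<Rightarrow> (nat \<Rightarrow> 'a set) \<Rightarrow> bool" where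
  "C_parties N p A B C X \<longleftrightarrow>
     A \<subseteq> N \<and> B \<subseteq> N \<and> C \<subseteq> N \<and> (\<forall>i\<in>{1..p}. X i \<subseteq> N) \<and>
     disjnt A B \<and> disjnt A C \<and> disjnt B C \<and>
     (\<forall>i\<in>{1..p}. disjnt A (X i) \<and> disjnt B (X i) \<and> disjnt C (X i)) \<and>
     disjoint_family_on X {1..p}"

definition C_instances :: "'a set \<Rightarrow> nat \<Rightarrow> 'a set \<Rightarrow> 'a set \<Rightarrow> 'a set \<Rightarrow> 'a form set" where
  "C_instances N p A B C = {C_form p A B C X | X. C_parties N p A B C X}"

definition derivable :: "'a set \<Rightarrow> 'a set \<Rightarrow> 'a set \<Rightarrow> 'a form set \<Rightarrow> 'a form \<Rightarrow> bool" where
  "derivable A B C \<F> G \<longleftrightarrow>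
     (\<exists>S c a b. finite S \<and> S \<subseteq> \<F> \<and> (\<forall>F\<in>S. 0 \<le> (c F :: real)) \<and>
        same_form G
          (\<lambda>h. (\<Sum>F\<in>S. c F * F h) + a * cond_mi A C B h + b * cond_mi B C A h))"

(* The family consists of the unconstrained instances U N on each ground set N and the
   inequalities C_p for p in P. Ground sets are finite sets of natural numbers, which
   covers every finite set up to relabelling. *)
definition C_independent :: "nat \<Rightarrow> (nat set \<Rightarrow> nat form set) \<Rightarrow> nat set \<Rightarrow> bool" where
  "C_independent n U P \<longleftrightarrow>
     (\<exists>N A B C. finite N \<and>
        (\<exists>G\<in>C_instances N n A B C.
           \<not> derivable A B C (U N \<union> (\<Union>p\<in>P. C_instances N p A B C)) G))"

end

theory Submission
  imports Defs
begin

text \<open>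
  It suffices to find one monotone submodular function h that vanishes on both constraints,
  satisfies all C_p with \<open>p \<noteq> n\<close> and violates C_n: monotonicity implies weak monotonicity, so the
  same h serves the quantum and the classical case. Take singletons A, B, C and \<open>X\<^sub>1, \<dots>, X\<^sub>n\<close>, and let
  h(M) depend only on the intersection of M with \<open>A \<union> B \<union> C\<close> and on the number k of the other parties
  in M. For fixed intersection h is affine in k except for corrections at k = 0 and k = 1, chosen so
  that, for sets \<open>X\<^sub>i\<close> with \<open>k\<^sub>i\<close> elements and \<open>K = \<Sum>k\<^sub>i\<close>, the left-hand side of C_p equals
  \<open>\<Sum>c(k\<^sub>i) - 2 + 2(n - K)\<close> where \<open>c(0) = 2n - 2\<close>, \<open>c(1) = 0\<close>, and \<open>c(k) = 2\<close> for \<open>k \<ge> 2\<close>.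
  As \<open>K \<le> n\<close>, this is negative only if \<open>K = n\<close> and all \<open>k\<^sub>i = 1\<close>, that is, only for \<open>p = n\<close>.
\<close>

section \<open>Submodularity from exchanges of two elements\<close>

text \<open>Adding the elements of \<alpha> and \<beta> to \<gamma> one at a time splits the
  inequality into local ones that telescope.\<close>

lemma cond_mi_nonneg_if_locally_submodular:
  fixes f :: "'a set \<Rightarrow> real"
  assumes "finite N"
    and local: "\<And>M i j. M \<subseteq> N \<Longrightarrow> i \<in> N - M \<Longrightarrow> j \<in> N - M \<Longrightarrow> i \<noteq> j \<Longrightarrow>
      f M + f (insert i (insert j M)) \<le> f (insert i M) + f (insert j M)"
    and "\<alpha> \<subseteq> N" "\<beta> \<subseteq> N" "\<gamma> \<subseteq> N" "disjnt \<alpha> \<beta>" "disjnt \<alpha> \<gamma>" "disjnt \<beta> \<gamma>"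
  shows "0 \<le> cond_mi \<alpha> \<beta> \<gamma> f"
proof -
  \<comment> \<open>This is the case of a singleton \<alpha>; the induction on \<alpha> below
    applies it over the base \<alpha> \<union> \<gamma>.\<close>
  have single: "f M + f (insert i (\<beta> \<union> M)) \<le> f (insert i M) + f (\<beta> \<union> M)"
    if "M \<subseteq> N" "i \<in> N - M - \<beta>" "disjnt \<beta> M" for M i
  proof -
    have "finite \<beta>" using assms finite_subset by blast
    then show ?thesis using that \<open>\<beta> \<subseteq> N\<close>
    proof (induction \<beta>)
      case (insert j \<beta>)
      then have "f M + f (insert i (\<beta> \<union> M)) \<le> f (insert i M) + f (\<beta> \<union> M)"
        by (auto simp: disjnt_def)
      moreover have "f (\<beta> \<union> M) + f (insert i (insert j (\<beta> \<union> M)))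
          \<le> f (insert i (\<beta> \<union> M)) + f (insert j (\<beta> \<union> M))"
        using insert by (intro local) (auto simp: disjnt_def)
      ultimately show ?case by simp
    qed simp
  qed
  have "finite \<alpha>" using assms finite_subset by blast
  then have "f \<gamma> + f (\<alpha> \<union> \<beta> \<union> \<gamma>) \<le> f (\<alpha> \<union> \<gamma>) + f (\<beta> \<union> \<gamma>)"
    using \<open>\<alpha> \<subseteq> N\<close> \<open>disjnt \<alpha> \<beta>\<close> \<open>disjnt \<alpha> \<gamma>\<close>
  proof (induction \<alpha>)
    case (insert i \<alpha>)
    then have "f \<gamma> + f (\<alpha> \<union> \<beta> \<union> \<gamma>) \<le> f (\<alpha> \<union> \<gamma>) + f (\<beta> \<union> \<gamma>)"
      by (auto simp: disjnt_def)
    moreover have "f (\<alpha> \<union> \<gamma>) + f (insert i (\<beta> \<union> (\<alpha> \<union> \<gamma>)))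
        \<le> f (insert i (\<alpha> \<union> \<gamma>)) + f (\<beta> \<union> (\<alpha> \<union> \<gamma>))"
      using insert assms by (intro single) (auto simp: disjnt_def)
    ultimately show ?case by (simp add: ac_simps)
  qed simp
  then show ?thesis by (simp add: cond_mi_def)
qed

section \<open>The witness function\<close>

text \<open>The slopes for B and ABC have the same sum as those for AB and BC, so the affine parts
  satisfy h(A:C|B) = 0, and by symmetry h(B:C|A) = 0.\<close>

definition slope :: "nat \<Rightarrow> bool \<Rightarrow> bool \<Rightarrow> bool \<Rightarrow> real" where
  "slope n a b c =
     (if a \<and> b then if c then 0 else 2 * real n - 2
      else if a \<or> b then if c then 2 * real n - 1 else 4 * real n - 3
      else if c then 4 * real n else 6 * real n - 2)"

text \<open>The entry at k = 1 lowers h(A \<union> X_i) and h(B \<union> X_i) by one each for a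
  singleton X_i; this removes the 2 that larger X_i contribute to C_p.\<close>

definition correction :: "nat \<Rightarrow> bool \<Rightarrow> bool \<Rightarrow> bool \<Rightarrow> nat \<Rightarrow> real" where
  "correction n a b c k =
     (if k = 0 then
        if a \<and> b then if c then 4 * real n - 2 else 2 * real n
        else if a \<or> b then if c then 2 * real n else 2
        else 0
      else if k = 1 \<and> a \<noteq> b then 1 else 0)"

text \<open>Written in n - k so that for n \<ge> 2 all eight lines meet at k = n, in the largest
  value.\<close>

definition profile :: "nat \<Rightarrow> bool \<Rightarrow> bool \<Rightarrow> bool \<Rightarrow> nat \<Rightarrow> real" where
  "profile n a b c k =
     real n * (6 * real n - 2) - slope n a b c * (real n - real k) - correction n a b c k"

text \<open>The parties 0, 1, 2 are A, B, C; the other n parties are interchangeable.\<close>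

definition witness :: "nat \<Rightarrow> nat set \<Rightarrow> real" where
  "witness n M = profile n (0 \<in> M) (1 \<in> M) (2 \<in> M) (card (M \<inter> {3..n+2}))"

lemmas profile_defs = profile_def slope_def correction_def

text \<open>The affine part cancels, and wherever the correction at 1 is 1, the one at 0 is at least
  2.\<close>

lemma profile_concave:
  assumes "n \<ge> 2"
  shows "profile n a b c k + profile n a b c (k + 2) \<le> 2 * profile n a b c (k + 1)"
  using assms unfolding profile_defs
  by (cases a; cases b; cases c; cases "k = 0"; cases "k = 1") (auto simp: algebra_simps)

text \<open>For k \<ge> 1 the decrease of the slopes dominates. From k = 0 to 1 the corrections make
  the gain 4n - 2 for every trace that meets {A, B}; it is 4n for C alone and 6n - 2 for the empty
  trace.\<close>

lemma profile_increment_antimono: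
  assumes "n \<ge> 2"
  shows "profile n False b c k + profile n True b c (k + 1)
           \<le> profile n True b c k + profile n False b c (k + 1)"
    and "profile n a False c k + profile n a True c (k + 1)
           \<le> profile n a True c k + profile n a False c (k + 1)"
    and "profile n a b False k + profile n a b True (k + 1)
           \<le> profile n a b True k + profile n a b False (k + 1)"
  using assms unfolding profile_defs
  by (cases a; cases b; cases c; cases "k = 0"; auto simp: algebra_simps)+

text \<open>For the pair A, B the slopes contribute 2 (n - k), which at k = 1 has to absorb two
  units of correction. For pairs with C the slopes cancel and the corrections decide.\<close>

lemma profile_submodular:
  assumes "n \<ge> 2" "k \<le> n"
  shows "profile n False False c k + profile n True True c k
           \<le> profile n True False c k + profile n False True c k"
    and "profile n False b False k + profile n True b True k
           \<le> profile n True b False k + profile n False b True k"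
    and "profile n a False False k + profile n a True True k
           \<le> profile n a True False k + profile n a False True k"
  using assms unfolding profile_defs
  by (cases a; cases b; cases c; cases "k = 0"; cases "k = 1"; auto simp: algebra_simps)+

lemma profile_le:
  assumes "n \<ge> 2" "k \<le> n"
  shows "profile n a b c k \<le> real n * (6 * real n - 2)"
proof -
  have "slope n a b c \<ge> 0" "correction n a b c k \<ge> 0"
    using assms by (auto simp: slope_def correction_def)
  moreover have "0 \<le> slope n a b c * (real n - real k)"
    using calculation assms by simp
  ultimately show ?thesis unfolding profile_def by linarith
qed

lemma card_middle_le: "card (M \<inter> {3..n+2}) \<le> n"
  using card_mono[of "{3..n+2}" "M \<inter> {3..n+2}"] by simp

lemma witness_insert:
  assumes "i \<in> {0..n+2} - M"
  shows "witness n (insert i M) =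
    (let k = card (M \<inter> {3..n+2}) in
     profile n (i = 0 \<or> 0 \<in> M) (i = 1 \<or> 1 \<in> M) (i = 2 \<or> 2 \<in> M) (if i < 3 then k else k + 1))"
  using assms by (auto simp: witness_def Let_def eq_commute[of "Suc 0"])

text \<open>By symmetry i < j. Either both are among A, B, C, or just i is, or neither; each
  situation is one of the inequalities for \<open>profile\<close>.\<close>

lemma witness_locally_submodular:
  assumes "n \<ge> 2" "M \<subseteq> {0..n+2}" "i \<in> {0..n+2} - M" "j \<in> {0..n+2} - M" "i \<noteq> j"
  shows "witness n M + witness n (insert i (insert j M))
    \<le> witness n (insert i M) + witness n (insert j M)"
  using assms(3-5)
proof (induction i j rule: linorder_wlog)
  case (sym i j)
  then show ?case by (auto simp: insert_commute add.commute)
next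
  case (le i j)
  define k where "k = card (M \<inter> {3..n+2})"
  have k: "k \<le> n" unfolding k_def by (rule card_middle_le)
  have "card (insert j M \<inter> {3..n+2}) = (if j < 3 then k else k + 1)"
    using le by (auto simp: k_def)
  then have ij: "witness n (insert i (insert j M)) =
     profile n (i = 0 \<or> j = 0 \<or> 0 \<in> M) (i = 1 \<or> j = 1 \<or> 1 \<in> M) (i = 2 \<or> j = 2 \<or> 2 \<in> M)
       (k + (if i < 3 then 0 else 1) + (if j < 3 then 0 else 1))"
    using le by (subst witness_insert) (auto simp: Let_def eq_commute[of "Suc 0"])
  note witness = ij witness_insert[OF le(2), folded k_def, unfolded Let_def]
    witness_insert[OF le(3), folded k_def, unfolded Let_def] witness_def[of n M, folded k_def]
  have "i = 0 \<or> i = 1 \<or> i = 2 \<or> 3 \<le> i" "j = 0 \<or> j = 1 \<or> j = 2 \<or> 3 \<le> j" by auto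
  then consider "i = 0" "j = 1" | "i = 0" "j = 2" | "i = 1" "j = 2"
    | "i = 0" "3 \<le> j" | "i = 1" "3 \<le> j" | "i = 2" "3 \<le> j" | "3 \<le> i" "3 \<le> j"
    using le(1,4) by (elim disjE) auto
  then show ?case
  proof cases
    case 1
    with le profile_submodular(1)[OF assms(1) k, of "2 \<in> M"] show ?thesis
      unfolding witness by simp
  next
    case 2
    with le profile_submodular(2)[OF assms(1) k, of "1 \<in> M"] show ?thesis
      unfolding witness by simp
  next
    case 3
    with le profile_submodular(3)[OF assms(1) k, of "0 \<in> M"] show ?thesis
      unfolding witness by simp
  next
    case 4
    with le profile_increment_antimono(1)[OF assms(1), of "1 \<in> M" "2 \<in> M" k] show ?thesis
      unfolding witness by simp
  next
    case 5
    with le profile_increment_antimono(2)[OF assms(1), of "0 \<in> M" "2 \<in> M" k] show ?thesis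
      unfolding witness by simp
  next
    case 6
    with le profile_increment_antimono(3)[OF assms(1), of "0 \<in> M" "1 \<in> M" k] show ?thesis
      unfolding witness by simp
  next
    case 7
    with profile_concave[OF assms(1), of "0 \<in> M" "1 \<in> M" "2 \<in> M" k] show ?thesis
      unfolding witness by simp
  qed
qed

section \<open>The basic inequalities\<close>

lemma witness_ssa:
  assumes "n \<ge> 2" "F \<in> strong_subadditivity {0..n+2}"
  shows "0 \<le> F (witness n)"
proof -
  from assms(2) obtain \<alpha> \<beta> \<gamma> where "F = cond_mi \<alpha> \<beta> \<gamma>"
    and sets: "\<alpha> \<subseteq> {0..n+2}" "\<beta> \<subseteq> {0..n+2}" "\<gamma> \<subseteq> {0..n+2}"
      "disjnt \<alpha> \<beta>" "disjnt \<alpha> \<gamma>" "disjnt \<beta> \<gamma>"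
    unfolding strong_subadditivity_def by blast
  moreover have "0 \<le> cond_mi \<alpha> \<beta> \<gamma> (witness n)"
    by (rule cond_mi_nonneg_if_locally_submodular[OF finite_atLeastAtMost _ sets])
      (rule witness_locally_submodular[OF assms(1)])
  ultimately show ?thesis by simp
qed

text \<open>By submodularity \<beta> adds at least as much to \<alpha> as to the complement of
  \<beta>, and there the gain is non-negative because the ground set attains the maximum.\<close>

lemma witness_mono:
  assumes "n \<ge> 2" "\<alpha> \<subseteq> {0..n+2}" "\<beta> \<subseteq> {0..n+2}" "disjnt \<alpha> \<beta>"
  shows "witness n \<alpha> \<le> witness n (\<alpha> \<union> \<beta>)"
proof -
  let ?N = "{0..n+2}"
  have "cond_mi \<beta> (?N - \<alpha> - \<beta>) \<alpha> \<in> strong_subadditivity ?N"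
    using assms unfolding strong_subadditivity_def disjnt_def by blast
  from witness_ssa[OF \<open>n \<ge> 2\<close> this]
  have "witness n \<alpha> + witness n (\<beta> \<union> (?N - \<alpha> - \<beta>) \<union> \<alpha>)
      \<le> witness n (\<beta> \<union> \<alpha>) + witness n (?N - \<alpha> - \<beta> \<union> \<alpha>)"
    by (simp add: cond_mi_def)
  moreover have "\<beta> \<union> (?N - \<alpha> - \<beta>) \<union> \<alpha> = ?N" using assms by auto
  moreover have "witness n ?N = real n * (6 * real n - 2)"
  proof -
    have "?N \<inter> {3..n+2} = {3..n+2}" by auto
    then show ?thesis using assms by (simp add: witness_def profile_defs)
  qed
  moreover have "witness n (?N - \<alpha> - \<beta> \<union> \<alpha>) \<le> real n * (6 * real n - 2)"
    unfolding witness_def by (intro profile_le card_middle_le assms)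
  ultimately show ?thesis by (simp add: Un_commute)
qed

lemma witness_basic_classical:
  assumes "n \<ge> 2" "F \<in> basic_classical {0..n+2}"
  shows "0 \<le> F (witness n)"
  using assms witness_ssa witness_mono
  by (auto simp: basic_classical_def monotonicity_def)

lemma witness_basic_quantum:
  assumes "n \<ge> 2" "F \<in> basic_quantum {0..n+2}"
  shows "0 \<le> F (witness n)"
proof -
  have "0 \<le> F (witness n)" if "F \<in> weak_monotonicity {0..n+2}"
  proof -
    from that obtain \<alpha> \<beta> \<gamma>
      where F: "F = (\<lambda>h. h (\<alpha> \<union> \<beta>) + h (\<alpha> \<union> \<gamma>) - h \<beta> - h \<gamma>)"
        and "\<alpha> \<subseteq> {0..n+2}" "\<beta> \<subseteq> {0..n+2}" "\<gamma> \<subseteq> {0..n+2}" "disjnt \<alpha> \<beta>" "disjnt \<alpha> \<gamma>"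
      unfolding weak_monotonicity_def by blast
    then have "witness n \<beta> \<le> witness n (\<beta> \<union> \<alpha>)" "witness n \<gamma> \<le> witness n (\<gamma> \<union> \<alpha>)"
      using assms(1) by (auto intro!: witness_mono simp: disjnt_sym)
    then show ?thesis by (simp add: F Un_commute)
  qed
  then show ?thesis using assms witness_ssa by (auto simp: basic_quantum_def)
qed

section \<open>Values of C_p at the witness\<close>

text \<open>This is c(k) of the overview: what an X_i with k elements contributes beyond an affine
  function of k.\<close>

definition excess :: "nat \<Rightarrow> nat \<Rightarrow> real" where
  "excess n k = (if k = 0 then 2 * real n - 2 else if k = 1 then 0 else 2)"

lemma C_parties_subset:
  fixes n :: nat
  assumes "C_parties {0..n+2} p {0} {1} {2} X" "i \<in> {1..p}"
  shows "X i \<subseteq> {3..n+2}"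
proof
  fix x assume x: "x \<in> X i"
  have X: "X i \<subseteq> {0..n+2}" "0 \<notin> X i" "1 \<notin> X i" "2 \<notin> X i"
    using assms unfolding C_parties_def disjnt_def by simp_all
  then have "x \<noteq> 0" "x \<noteq> 1" "x \<noteq> 2" using x by metis+
  moreover have "x \<le> n + 2" using X(1) x by auto
  ultimately show "x \<in> {3..n+2}" by simp
qed

lemma C_parties_card:
  fixes n :: nat
  assumes "C_parties {0..n+2} p {0} {1} {2} X"
  shows "card (\<Union>i\<in>{1..p}. X i) = (\<Sum>i=1..p. card (X i))"
  using assms finite_subset[of _ "{0..n+2}"]
  by (intro card_UN_disjoint') (auto simp: C_parties_def)

lemma C_form_witness:
  assumes "n \<ge> 2" "C_parties {0..n+2} p {0} {1} {2} X"
  shows "C_form p {0} {1} {2} X (witness n) =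
    (\<Sum>i=1..p. excess n (card (X i))) - 2 + 2 * (real n - real (\<Sum>i=1..p. card (X i)))"
proof -
  let ?h = "witness n"
  note X = C_parties_subset[OF assms(2)]
  have eval: "?h (T \<union> Y) = profile n (0 \<in> T) (1 \<in> T) (2 \<in> T) (card Y)"
    if "T \<subseteq> {0,1,2}" "Y \<subseteq> {3..n+2}" for T Y
  proof -
    have "(T \<union> Y) \<inter> {3..n+2} = Y" "0 \<in> T \<union> Y \<longleftrightarrow> 0 \<in> T" "1 \<in> T \<union> Y \<longleftrightarrow> 1 \<in> T"
      "2 \<in> T \<union> Y \<longleftrightarrow> 2 \<in> T"
      using that by auto
    then show ?thesis by (simp only: witness_def)
  qed
  \<comment> \<open>The two occurrences of h(X_i) cancel, so only the traces A, B and AB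
    enter.\<close>
  have summand: "cond_mi {0} {1} (X i) ?h + ?h (X i)
      = excess n (card (X i)) + (6 * real n - 4) * real (card (X i)) + (2 * real n - 2)"
    if "i \<in> {1..p}" for i
    using eval[OF _ X[OF that], of "{0}"] eval[OF _ X[OF that], of "{1}"]
      eval[OF _ X[OF that], of "{0} \<union> {1}"]
    by (auto simp: cond_mi_def profile_defs excess_def algebra_simps)
  have "cond_mi ({0} \<union> {1}) {2} {} ?h = 2 * real n - 2"
    using eval[of "{}" "{}"] eval[of "{2}" "{}"] eval[of "{0} \<union> {1}" "{}"]
      eval[of "{0} \<union> {1} \<union> {2}" "{}"]
    by (simp add: cond_mi_def profile_defs algebra_simps)
  moreover have "?h (\<Union>i\<in>{1..p}. X i) = (6 * real n - 2) * real (\<Sum>i=1..p. card (X i))"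
  proof -
    have sub: "(\<Union>i\<in>{1..p}. X i) \<subseteq> {3..n+2}" using X by blast
    have "profile n False False False k = (6 * real n - 2) * real k" for k
      by (simp add: profile_defs algebra_simps)
    then show ?thesis
      using eval[of "{}", OF _ sub] C_parties_card[OF assms(2)] by simp
  qed
  moreover have "(\<Sum>i=1..p. cond_mi {0} {1} (X i) ?h) + (\<Sum>i=1..p. ?h (X i)) =
      (\<Sum>i=1..p. excess n (card (X i))) + (6 * real n - 4) * real (\<Sum>i=1..p. card (X i))
      + real p * (2 * real n - 2)"
  proof -
    have "(\<Sum>i=1..p. cond_mi {0} {1} (X i) ?h + ?h (X i)) =
        (\<Sum>i=1..p. excess n (card (X i)) + (6 * real n - 4) * real (card (X i)) + (2 * real n - 2))"
      by (rule sum.cong[OF refl summand])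
    then show ?thesis by (simp add: sum.distrib sum_distrib_left)
  qed
  \<comment> \<open>With K the sum of the cardinalities, the terms in K leave -2K, and those in 2n -
    2 occur p - (p - 1) = 1 times.\<close>
  ultimately show ?thesis
    unfolding C_form_def by (simp only:) (simp add: algebra_simps)
qed

lemma C_form_witness_nonneg:
  assumes "n \<ge> 2" "p \<noteq> n" and par: "C_parties {0..n+2} p {0} {1} {2} X"
  shows "0 \<le> C_form p {0} {1} {2} X (witness n)"
proof -
  let ?K = "\<Sum>i=1..p. card (X i)"
  have ex: "excess n k \<ge> 0" for k using \<open>n \<ge> 2\<close> by (simp add: excess_def)
  have "?K = card (\<Union>i\<in>{1..p}. X i)"
    by (rule C_parties_card[OF par, symmetric])
  also have "\<dots> \<le> card {3..n+2}"
  proof (intro card_mono)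
    show "(\<Union>i\<in>{1..p}. X i) \<subseteq> {3..n+2}"
      using C_parties_subset[OF par] by blast
  qed simp
  finally have K: "?K \<le> n" by simp
  show ?thesis
  proof (cases "?K = n")
    case True
    have "\<exists>i\<in>{1..p}. card (X i) \<noteq> 1"
    proof (rule ccontr)
      assume "\<not> ?thesis"
      then have "?K = p" by simp
      with True \<open>p \<noteq> n\<close> show False by simp
    qed
    then obtain i where i: "i \<in> {1..p}" "card (X i) \<noteq> 1" by blast
    \<comment> \<open>An empty X_i gives 2n - 2, which is at least 2 as n \<ge> 2.\<close>
    have "2 \<le> excess n (card (X i))"
      using i \<open>n \<ge> 2\<close> by (simp add: excess_def)
    also have "\<dots> \<le> (\<Sum>i=1..p. excess n (card (X i)))"
      using i ex by (intro member_le_sum) auto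
    finally show ?thesis unfolding C_form_witness[OF assms(1) par] True by simp
  next
    case False
    \<comment> \<open>By integrality 2 (n - K) is at least 2 and absorbs the -2.\<close>
    with K have "real ?K + 1 \<le> real n" by linarith
    moreover have "0 \<le> (\<Sum>i=1..p. excess n (card (X i)))" by (intro sum_nonneg ex)
    ultimately show ?thesis using C_form_witness[OF assms(1) par] by simp
  qed
qed

section \<open>Separation of C_n from the family\<close>

text \<open>The shift by 2 maps the indices 1..n onto all the parties other than A, B, C, so K = n
  here.\<close>

lemma C_parties_singletons: "C_parties {0..n+2} n {0} {1} {2} (\<lambda>i. {i + 2})"
  by (auto simp: C_parties_def disjoint_family_on_def)

text \<open>Evaluation at the witness separates: it is non-negative on the family, -2 on this
  instance of C_n, and zero on the constraint forms, whatever the signs of their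
  coefficients.\<close>

lemma C_independent_if_witness_nonneg:
  assumes "n \<ge> 2" and U: "\<And>F. F \<in> U {0..n+2} \<Longrightarrow> 0 \<le> F (witness n)"
  shows "C_independent n U {p. p \<ge> 1 \<and> p \<noteq> n}"
proof -
  let ?h = "witness n" and ?N = "{0..n+2}"
  let ?\<F> = "U ?N \<union> (\<Union>p\<in>{p. p \<ge> 1 \<and> p \<noteq> n}. C_instances ?N p {0} {1} {2})"
  let ?G = "C_form n {0} {1} {2} (\<lambda>i. {i + 2})"
  have nonneg: "0 \<le> F ?h" if "F \<in> ?\<F>" for F
    using that U C_form_witness_nonneg[OF \<open>n \<ge> 2\<close>] by (auto simp: C_instances_def)
  have G: "?G ?h = - 2"
    using C_form_witness[OF \<open>n \<ge> 2\<close> C_parties_singletons] by (simp add: excess_def)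
  have empty: "?h {} = 0" by (simp add: witness_def profile_defs)
  have constraints: "cond_mi {0} {2} {1} ?h = 0" "cond_mi {1} {2} {0} ?h = 0"
    by (simp_all add: cond_mi_def witness_def profile_defs algebra_simps)
  have "\<not> derivable {0} {1} {2} ?\<F> ?G"
  proof
    assume "derivable {0} {1} {2} ?\<F> ?G"
    then obtain S c a b where S: "S \<subseteq> ?\<F>" "\<forall>F\<in>S. 0 \<le> (c F :: real)"
      and "same_form ?G (\<lambda>h. (\<Sum>F\<in>S. c F * F h)
             + a * cond_mi {0} {2} {1} h + b * cond_mi {1} {2} {0} h)"
      unfolding derivable_def by blast
    then have "?G ?h = (\<Sum>F\<in>S. c F * F ?h)"
      using empty constraints by (simp add: same_form_def)
    moreover have "\<dots> \<ge> 0"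
      using S nonneg by (intro sum_nonneg mult_nonneg_nonneg) auto
    ultimately show False using G by simp
  qed
  moreover have "?G \<in> C_instances ?N n {0} {1} {2}"
    unfolding C_instances_def using C_parties_singletons by blast
  ultimately show ?thesis unfolding C_independent_def by (meson finite_atLeastAtMost)
qed

theorem mainTheorem2:
  fixes n :: nat
  assumes "n \<ge> 2"
  shows "C_independent n basic_quantum {p. p \<ge> 1 \<and> p \<noteq> n} \<and>
         C_independent n basic_classical {p. p \<ge> 1 \<and> p \<noteq> n}"
  using assms C_independent_if_witness_nonneg witness_basic_quantum witness_basic_classical
  by blast

end
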